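(* Let $A$ and $I$ be finite sets with $|A|\geq 2$, and let $\mathrm{NC}_I\subseteq A^I$ be the set of non-constant sequences. A simplicial complex over $I$ generates $\mathrm{NC}_I$ if and only if it is connected. In other words, the minimal complexes generating $\mathrm{NC}_I$ are the trees spanning $I$.
   Context: All sets are finite. For $f:B^J\to A^I$ write $f_i(x)=f(x)_i$. For $i\in I$, the input window $\mathcal{W}_f(i)$ is the smallest set $W\subseteq J$ (it exists) such that for all $x,y\in B^J$, $x|_W=y|_W$ implies $f_i(x)=f_i(y)$. A simplicial complex (or complex) over a set $I$ is a collection of subsets of $I$, called its simplices, that is closed under taking subsets. The communication complex $K_f$ of $f$ is the complex over $I$ defined, for $S\subseteq I$, by: $S\in K_f$ iff $\bigcap_{i\in S}\mathcal{W}_f(i)\neq\emptyset$ (for $S=\emptyset$ the intersection is $J$). A complex $K$ over $I$ generates a language $L\subseteq A^I$ if there exist finite sets $B,J$ and a function $f:B^J\to A^I$ with image exactly $L$ and $K_f\subseteq K$. A complex generating $L$ is minimal if no complex strictly contained in it generates $L$. A complex over $I$ is disconnected if there is a partition $I=I_0\sqcup I_1$ into two non-empty sets such that every simplex is contained in $I_0$ or in $I_1$; otherwise it is connected. A tree spanning $I$ is a tree with vertex set $I$, regarded as a complex whose simplices are its vertices and edges (and the empty set).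
   Formalization: The complex with no simplices at all is excluded when |I| ≤ 1 (it is connected but does not generate the empty language), and the description of minimal complexes as spanning trees is stated for |I| ≥ 2 (for |I| = 1 the minimal complex is {∅}, not a tree). *)

theory Defs
  imports Main "HOL-Library.FuncSet"
begin

text \<open>Sequences in \<open>A\<^sup>I\<close> are the extensional functions \<open>I \<rightarrow>\<^sub>E A\<close>, and a function
  \<open>f : B\<^sup>J \<rightarrow> A\<^sup>I\<close> has type \<open>('j \<Rightarrow> 'b) \<Rightarrow> ('i \<Rightarrow> 'a)\<close>, so that \<open>f x i\<close> is \<open>f\<^sub>i(x)\<close>;
  only its values on \<open>J \<rightarrow>\<^sub>E B\<close> are relevant.\<close>

definition determines ::
    "'b set \<Rightarrow> 'j set \<Rightarrow> (('j \<Rightarrow> 'b) \<Rightarrow> ('i \<Rightarrow> 'a)) \<Rightarrow> 'i \<Rightarrow> 'j set \<Rightarrow> bool" where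
  "determines B J f i W \<longleftrightarrow> W \<subseteq> J \<and>
     (\<forall>x \<in> J \<rightarrow>\<^sub>E B. \<forall>y \<in> J \<rightarrow>\<^sub>E B. (\<forall>j\<in>W. x j = y j) \<longrightarrow> f x i = f y i)"

text \<open>The least such set exists when \<open>J\<close> is finite: see \<open>window_determines\<close>
  and \<open>window_least\<close> below.\<close>

definition window ::
    "'b set \<Rightarrow> 'j set \<Rightarrow> (('j \<Rightarrow> 'b) \<Rightarrow> ('i \<Rightarrow> 'a)) \<Rightarrow> 'i \<Rightarrow> 'j set" where
  "window B J f i = (LEAST W. determines B J f i W)"

text \<open>The collection with no simplices at all, not even the empty one, is allowed.\<close>

definition complex_over :: "'i set \<Rightarrow> 'i set set \<Rightarrow> bool" where
  "complex_over I K \<longleftrightarrow> K \<subseteq> Pow I \<and> (\<forall>S\<in>K. \<forall>T. T \<subseteq> S \<longrightarrow> T \<in> K)"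

text \<open>Intersecting with \<open>J\<close> gives the empty intersection its value \<open>J\<close>;
  for \<open>S \<noteq> {}\<close> it changes nothing, as windows are contained in \<open>J\<close>.\<close>

definition comm_complex ::
    "'i set \<Rightarrow> 'b set \<Rightarrow> 'j set \<Rightarrow> (('j \<Rightarrow> 'b) \<Rightarrow> ('i \<Rightarrow> 'a)) \<Rightarrow> 'i set set" where
  "comm_complex I B J f = {S. S \<subseteq> I \<and> J \<inter> (\<Inter>i\<in>S. window B J f i) \<noteq> {}}"

definition generates_by ::
    "'i set \<Rightarrow> 'i set set \<Rightarrow> ('i \<Rightarrow> 'a) set \<Rightarrow>
     'b set \<Rightarrow> 'j set \<Rightarrow> (('j \<Rightarrow> 'b) \<Rightarrow> ('i \<Rightarrow> 'a)) \<Rightarrow> bool" where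
  "generates_by I K L B J f \<longleftrightarrow>
     finite B \<and> finite J \<and> f ` (J \<rightarrow>\<^sub>E B) = L \<and> comm_complex I B J f \<subseteq> K"

text \<open>HOL cannot quantify over the types of \<open>B\<close> and \<open>J\<close>, so they are taken to be finite
  sets of natural numbers. This loses no generality: \<open>generates_by_imp_generates\<close> below
  covers finite sets of arbitrary types.\<close>

definition generates :: "'i set \<Rightarrow> 'i set set \<Rightarrow> ('i \<Rightarrow> 'a) set \<Rightarrow> bool" where
  "generates I K L \<longleftrightarrow>
     (\<exists>(B :: nat set) (J :: nat set) f. generates_by I K L B J f)"

definition minimal_generating :: "'i set \<Rightarrow> 'i set set \<Rightarrow> ('i \<Rightarrow> 'a) set \<Rightarrow> bool" where
  "minimal_generating I K L \<longleftrightarrow> complex_over I K \<and> generates I K L \<and>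
     \<not> (\<exists>K'. complex_over I K' \<and> K' \<subset> K \<and> generates I K' L)"

definition disconnected_complex :: "'i set \<Rightarrow> 'i set set \<Rightarrow> bool" where
  "disconnected_complex I K \<longleftrightarrow>
     (\<exists>I0 I1. I0 \<noteq> {} \<and> I1 \<noteq> {} \<and> I0 \<inter> I1 = {} \<and> I0 \<union> I1 = I \<and>
        (\<forall>S\<in>K. S \<subseteq> I0 \<or> S \<subseteq> I1))"

abbreviation connected_complex :: "'i set \<Rightarrow> 'i set set \<Rightarrow> bool" where
  "connected_complex I K \<equiv> \<not> disconnected_complex I K"

definition is_cycle :: "'i set set \<Rightarrow> 'i list \<Rightarrow> bool" where
  "is_cycle E vs \<longleftrightarrow> 3 \<le> length vs \<and> distinct vs \<and>
     (\<forall>k < length vs. {vs ! k, vs ! (Suc k mod length vs)} \<in> E)"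

text \<open>Trees are undirected graphs on \<open>V\<close> whose edges are two-element sets.\<close>

definition is_tree :: "'i set \<Rightarrow> 'i set set \<Rightarrow> bool" where
  "is_tree V E \<longleftrightarrow> V \<noteq> {} \<and> (\<forall>e\<in>E. e \<subseteq> V \<and> card e = 2) \<and>
     (\<forall>u\<in>V. \<forall>v\<in>V. (u, v) \<in> {(a, b). {a, b} \<in> E}\<^sup>*) \<and>
     \<not> (\<exists>vs. is_cycle E vs)"

definition spanning_tree_complex :: "'i set \<Rightarrow> 'i set set \<Rightarrow> bool" where
  "spanning_tree_complex I K \<longleftrightarrow>
     (\<exists>E. is_tree I E \<and> K = {{}} \<union> {{i} | i. i \<in> I} \<union> E)"

definition NC :: "'i set \<Rightarrow> 'a set \<Rightarrow> ('i \<Rightarrow> 'a) set" where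
  "NC I A = {x \<in> I \<rightarrow>\<^sub>E A. \<not> (\<exists>a\<in>A. \<forall>i\<in>I. x i = a)}"

lemma determines_subset: "determines B J f i W \<Longrightarrow> W \<subseteq> J"
  by (simp add: determines_def)

lemma determines_Int:
  assumes "determines B J f i V" and "determines B J f i W"
  shows "determines B J f i (V \<inter> W)"
  unfolding determines_def
proof (intro conjI ballI impI)
  show "V \<inter> W \<subseteq> J" using determines_subset[OF assms(1)] by blast
next
  fix x y
  assume x: "x \<in> J \<rightarrow>\<^sub>E B" and y: "y \<in> J \<rightarrow>\<^sub>E B" and eq: "\<forall>j\<in>V \<inter> W. x j = y j"
  define z where "z = (\<lambda>j. if j \<in> V then x j else y j)"
  have V: "V \<subseteq> J" using determines_subset[OF assms(1)] .
  have z: "z \<in> J \<rightarrow>\<^sub>E B"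
    using x y V by (auto simp: z_def PiE_iff extensional_def)
  have "\<forall>j\<in>V. x j = z j" by (simp add: z_def)
  then have "f x i = f z i" using assms(1) x z unfolding determines_def by blast
  also have "\<dots> = f y i"
  proof -
    have "\<forall>j\<in>W. z j = y j" using eq by (auto simp: z_def)
    then show ?thesis using assms(2) y z unfolding determines_def by blast
  qed
  finally show "f x i = f y i" .
qed

lemma window_aux:
  assumes "finite J"
  shows "determines B J f i (window B J f i) \<and>
    (\<forall>W. determines B J f i W \<longrightarrow> window B J f i \<subseteq> W)"
proof -
  have J: "determines B J f i J"
    unfolding determines_def
  proof (intro conjI ballI impI)
    fix x y assume "x \<in> J \<rightarrow>\<^sub>E B" "y \<in> J \<rightarrow>\<^sub>E B" "\<forall>j\<in>J. x j = y j"
    then have "x = y" by (intro PiE_ext) auto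
    then show "f x i = f y i" by simp
  qed simp
  obtain M where M: "determines B J f i M"
    and le: "\<And>W. determines B J f i W \<Longrightarrow> card M \<le> card W"
    using ex_has_least_nat[of "determines B J f i" J card] J by blast
  have sub: "M \<subseteq> W" if W: "determines B J f i W" for W
  proof -
    have "finite M" using determines_subset[OF M] assms by (rule finite_subset)
    moreover have "card M \<le> card (M \<inter> W)" using le determines_Int[OF M W] by blast
    ultimately have "M \<inter> W = M" by (meson card_seteq inf_le1)
    then show ?thesis by blast
  qed
  have "window B J f i = M"
    unfolding window_def by (rule Least_equality) (rule M, rule sub)
  then show ?thesis using M sub by simp
qed

lemma window_determines: "finite J \<Longrightarrow> determines B J f i (window B J f i)"
  by (simp add: window_aux)

lemma window_least:
  "finite J \<Longrightarrow> determines B J f i W \<Longrightarrow> window B J f i \<subseteq> W"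
  by (simp add: window_aux)

lemma generates_by_imp_generates:
  fixes B :: "'b set" and J :: "'j set" and f :: "('j \<Rightarrow> 'b) \<Rightarrow> ('i \<Rightarrow> 'a)"
  assumes gen: "generates_by I K L B J f"
  shows "generates I K L"
proof -
  have fin: "finite B" "finite J" and img: "f ` (J \<rightarrow>\<^sub>E B) = L"
    and sub: "comm_complex I B J f \<subseteq> K"
    using gen by (auto simp: generates_by_def)
  obtain h :: "'b \<Rightarrow> nat" where h: "inj_on h B"
    using finite_imp_inj_to_nat_seg[OF fin(1)] by blast
  obtain g :: "'j \<Rightarrow> nat" where g: "inj_on g J"
    using finite_imp_inj_to_nat_seg[OF fin(2)] by blast
  define B' J' where "B' = h ` B" and "J' = g ` J"
  define p where "p = (\<lambda>x. \<lambda>j\<in>J. inv_into B h (x (g j)))"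
  define f' where "f' = (\<lambda>x. f (p x))"
  have p_in: "p x \<in> J \<rightarrow>\<^sub>E B" if "x \<in> J' \<rightarrow>\<^sub>E B'" for x
    using that by (auto simp: p_def B'_def J'_def PiE_iff intro!: inv_into_into)
  have p_surj: "\<exists>x \<in> J' \<rightarrow>\<^sub>E B'. p x = y" if y: "y \<in> J \<rightarrow>\<^sub>E B" for y
  proof
    let ?x = "\<lambda>k\<in>J'. h (y (inv_into J g k))"
    show "?x \<in> J' \<rightarrow>\<^sub>E B'"
      using y g by (auto simp: B'_def J'_def PiE_iff)
    show "p ?x = y"
    proof
      fix j
      show "p ?x j = y j"
        using y g h by (cases "j \<in> J") (auto simp: p_def J'_def PiE_iff extensional_def)
    qed
  qed
  have img': "f' ` (J' \<rightarrow>\<^sub>E B') = L"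
  proof -
    have "p ` (J' \<rightarrow>\<^sub>E B') = J \<rightarrow>\<^sub>E B" using p_in p_surj by blast
    then have "f ` (p ` (J' \<rightarrow>\<^sub>E B')) = L" using img by simp
    then show ?thesis unfolding f'_def image_image .
  qed
  have fin': "finite B'" "finite J'" using fin by (auto simp: B'_def J'_def)
  have win: "window B' J' f' i \<subseteq> g ` window B J f i" for i
  proof (rule window_least[OF fin'(2)])
    note d = window_determines[OF fin(2), of B f i]
    show "determines B' J' f' i (g ` window B J f i)"
      unfolding determines_def
    proof (intro conjI ballI impI)
      show "g ` window B J f i \<subseteq> J'" using determines_subset[OF d] by (auto simp: J'_def)
    next
      fix x y assume xy: "x \<in> J' \<rightarrow>\<^sub>E B'" "y \<in> J' \<rightarrow>\<^sub>E B'"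
        and eq: "\<forall>j\<in>g ` window B J f i. x j = y j"
      have "\<forall>j\<in>window B J f i. p x j = p y j" using eq by (auto simp: p_def)
      then have "f (p x) i = f (p y) i"
        using d p_in[OF xy(1)] p_in[OF xy(2)] unfolding determines_def by blast
      then show "f' x i = f' y i" by (simp add: f'_def)
    qed
  qed
  have "comm_complex I B' J' f' \<subseteq> comm_complex I B J f"
  proof
    fix S assume "S \<in> comm_complex I B' J' f'"
    then obtain k where S: "S \<subseteq> I" and k: "k \<in> J'" "\<And>i. i \<in> S \<Longrightarrow> k \<in> window B' J' f' i"
      by (auto simp: comm_complex_def)
    obtain j where j: "j \<in> J" "k = g j" using k by (auto simp: J'_def)
    have "j \<in> window B J f i" if "i \<in> S" for i
    proof -
      have "window B J f i \<subseteq> J"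
        by (rule determines_subset[OF window_determines[OF fin(2)]])
      then show ?thesis using k(2)[OF that] win[of i] j g by (auto dest: inj_onD)
    qed
    then show "S \<in> comm_complex I B J f" using S j by (auto simp: comm_complex_def)
  qed
  then have "generates_by I K L B' J' f'"
    using fin' img' sub by (auto simp: generates_by_def)
  then show ?thesis by (auto simp: generates_def)
qed

end

theory Submission imports Defs begin

text \<open>Suppose \<open>K\<close> splits along \<open>I = I\<^sub>0 \<squnion> I\<^sub>1\<close>. Then the two halves of the output are
  independent, and mixing two outputs that take two values on the two halves in opposite order
  yields a constant one. Conversely, let \<open>T\<close> be a spanning tree of a connected \<open>K\<close>. Every edge
  of \<open>T\<close> proposes two distinct letters, one to each endpoint, and every vertex privately selects
  an incident edge and outputs the letter proposed to it. Since there are fewer edges than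
  vertices, some edge is selected by both its endpoints, so the output is not constant. A
  non-constant \<open>x\<close> is produced by choosing an edge on which \<open>x\<close> is not constant, letting both its
  endpoints select it, and letting every other vertex select the edge leading towards it.\<close>

section \<open>Connectivity through cuts\<close>

text \<open>Connectivity is tested on pairs only, so that one notion serves both a complex and the
  edge set of a graph.\<close>

definition cut_connected :: "'i set \<Rightarrow> 'i set set \<Rightarrow> bool" where
  "cut_connected I E \<longleftrightarrow>
     (\<forall>X. I \<inter> X \<noteq> {} \<longrightarrow> I - X \<noteq> {} \<longrightarrow> (\<exists>u\<in>I \<inter> X. \<exists>v\<in>I - X. {u, v} \<in> E))"

lemma cut_connectedE:
  assumes "cut_connected I E" "a \<in> I" "a \<in> X" "b \<in> I" "b \<notin> X"
  obtains u v where "u \<in> I" "u \<in> X" "v \<in> I" "v \<notin> X" "{u, v} \<in> E"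
  using assms unfolding cut_connected_def by blast

lemma cut_connected_mono: "cut_connected I E \<Longrightarrow> E \<subseteq> F \<Longrightarrow> cut_connected I F"
  unfolding cut_connected_def by blast

lemma complex_over_subset: "complex_over I K \<Longrightarrow> S \<in> K \<Longrightarrow> T \<subseteq> S \<Longrightarrow> T \<in> K"
  unfolding complex_over_def by blast

text \<open>A simplex meeting both sides of a cut contains a pair across it, and closure under
  subsets puts that pair into \<open>K\<close>.\<close>

lemma connected_complex_iff_cut_connected:
  assumes K: "complex_over I K"
  shows "connected_complex I K \<longleftrightarrow> cut_connected I K"
proof
  assume c: "connected_complex I K"
  show "cut_connected I K"
    unfolding cut_connected_def
  proof (intro allI impI)
    fix X assume "I \<inter> X \<noteq> {}" "I - X \<noteq> {}"
    then obtain S where S: "S \<in> K" "\<not> S \<subseteq> I \<inter> X" "\<not> S \<subseteq> I - X"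
      using c unfolding disconnected_complex_def by (metis Int_Diff_Un Int_Diff_disjoint)
    moreover have "S \<subseteq> I" using K S(1) unfolding complex_over_def by blast
    ultimately obtain u v where uv: "u \<in> S" "u \<in> I \<inter> X" "v \<in> S" "v \<in> I - X" by blast
    then have "{u, v} \<in> K" using complex_over_subset[OF K S(1)] by simp
    then show "\<exists>u\<in>I \<inter> X. \<exists>v\<in>I - X. {u, v} \<in> K" using uv by blast
  qed
next
  assume c: "cut_connected I K"
  show "connected_complex I K"
  proof
    assume "disconnected_complex I K"
    then obtain I0 I1 where I01: "I0 \<noteq> {}" "I1 \<noteq> {}" "I0 \<inter> I1 = {}" "I0 \<union> I1 = I"
      and S: "\<forall>S\<in>K. S \<subseteq> I0 \<or> S \<subseteq> I1"
      unfolding disconnected_complex_def by blast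
    then obtain a b where "a \<in> I" "a \<in> I0" "b \<in> I" "b \<notin> I0" by blast
    with c obtain u v where uv: "u \<in> I0" "v \<in> I" "v \<notin> I0" "{u, v} \<in> K"
      by (rule cut_connectedE)
    then have "u \<notin> I1" using I01(3) by blast
    then show False using bspec[OF S uv(4)] uv(3) by simp
  qed
qed

lemma cut_connected_ex_edge:
  assumes "cut_connected I E" "i \<in> I" "j \<in> I" "i \<noteq> j"
  obtains k where "k \<in> I" "k \<noteq> i" "{i, k} \<in> E"
proof -
  obtain u v where "u \<in> {i}" "v \<in> I" "v \<notin> {i}" "{u, v} \<in> E"
    using assms by (elim cut_connectedE[where X = "{i}" and a = i and b = j]) auto
  then show thesis using that by blast
qed

lemma card_ge_2_ex_neq:
  assumes "2 \<le> card I"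
  obtains j where "j \<in> I" "j \<noteq> i"
proof -
  have "\<not> I \<subseteq> {i}" using assms card_mono[of "{i}" I] by auto
  then show thesis using that by blast
qed

text \<open>If \<open>v\<close> were not reachable from \<open>u\<close>, an edge would leave the
  set of points reachable from \<open>u\<close>.\<close>

lemma cut_connected_imp_rtrancl:
  assumes "cut_connected I E" "u \<in> I" "v \<in> I"
  shows "(u, v) \<in> {(a, b). {a, b} \<in> E}\<^sup>*"
proof (rule ccontr)
  let ?R = "{(a, b). {a, b} \<in> E}"
  assume *: "(u, v) \<notin> ?R\<^sup>*"
  obtain a b where "(u, a) \<in> ?R\<^sup>*" "(u, b) \<notin> ?R\<^sup>*" "{a, b} \<in> E"
    by (rule cut_connectedE[OF assms(1,2), of "{w. (u, w) \<in> ?R\<^sup>*}" v])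
      (use * assms(3) in auto)
  then show False by (auto dest: rtrancl_into_rtrancl)
qed

lemma rtrancl_crossing:
  assumes "(a, b) \<in> R\<^sup>*" "a \<in> X" "b \<notin> X"
  obtains u v where "(u, v) \<in> R" "u \<in> X" "v \<notin> X"
proof -
  have "\<exists>u v. (u, v) \<in> R \<and> u \<in> X \<and> v \<notin> X"
    using assms by (induction rule: rtrancl_induct) auto
  then show thesis using that by blast
qed

lemma rtrancl_imp_cut_connected:
  assumes E: "\<And>e. e \<in> E \<Longrightarrow> e \<subseteq> I"
    and R: "\<And>u v. u \<in> I \<Longrightarrow> v \<in> I \<Longrightarrow> (u, v) \<in> {(a, b). {a, b} \<in> E}\<^sup>*"
  shows "cut_connected I E"
  unfolding cut_connected_def
proof (intro allI impI)
  fix X assume "I \<inter> X \<noteq> {}" "I - X \<noteq> {}"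
  then obtain a b where "a \<in> I" "a \<in> X" "b \<in> I" "b \<notin> X" by blast
  then obtain u v where "{u, v} \<in> E" "u \<in> X" "v \<notin> X"
    using rtrancl_crossing[OF R] by blast
  then show "\<exists>u\<in>I \<inter> X. \<exists>v\<in>I - X. {u, v} \<in> E" using E by blast
qed

text \<open>Distinctness is what later lets such a path close up to a cycle.\<close>

lemma rtrancl_imp_distinct_path:
  assumes "(u, v) \<in> R\<^sup>*"
  shows "\<exists>vs. vs \<noteq> [] \<and> distinct vs \<and> hd vs = u \<and> last vs = v \<and>
    successively (\<lambda>a b. (a, b) \<in> R) vs"
  using assms
proof (induction rule: converse_rtrancl_induct)
  case base
  show ?case by (rule exI[of _ "[v]"]) simp
next
  case (step y z)
  then obtain vs where vs: "vs \<noteq> []" "distinct vs" "hd vs = z" "last vs = v"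
    "successively (\<lambda>a b. (a, b) \<in> R) vs" by blast
  show ?case
  proof (cases "y \<in> set vs")
    case True
    \<comment> \<open>The path already visits \<open>y\<close>, so it is shortened to its part
      starting there.\<close>
    then obtain as bs where "vs = as @ y # bs" by (meson split_list)
    then show ?thesis using vs
      by (intro exI[of _ "y # bs"]) (auto simp: successively_append_iff)
  next
    case False
    then show ?thesis using vs step.hyps
      by (intro exI[of _ "y # vs"]) (auto simp: successively_Cons)
  qed
qed

section \<open>Spanning trees grown from a root edge\<close>

lemma finite_grow_induct:
  assumes "finite I" "V \<subseteq> I" "P V"
    and step: "\<And>V. V \<subset> I \<Longrightarrow> P V \<Longrightarrow> \<exists>w\<in>I - V. P (insert w V)"
  shows "P I"
  using assms(2,3)
proof (induction "card (I - V)" arbitrary: V rule: less_induct)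
  case less
  show ?case
  proof (cases "V = I")
    case False
    then obtain w where w: "w \<in> I - V" "P (insert w V)" using less.prems step by blast
    have "I - insert w V \<subset> I - V" using w by blast
    then have "card (I - insert w V) < card (I - V)"
      using \<open>finite I\<close> by (intro psubset_card_mono) auto
    then show ?thesis using less.hyps[of "insert w V"] w less.prems by blast
  qed (use less.prems in simp)
qed

text \<open>The function \<open>p\<close> maps every vertex other than \<open>u\<close> and \<open>v\<close> to the edge to its parent in a
  spanning tree rooted at the edge \<open>{u, v}\<close>.\<close>

lemma cut_connected_ex_parent_edges:
  assumes fin: "finite I" and conn: "cut_connected I E"
    and uv: "u \<in> I" "v \<in> I" "u \<noteq> v" "{u, v} \<in> E"
  obtains p where "p u = {u, v}" "p v = {u, v}" "inj_on p (I - {u})" "cut_connected I (p ` I)"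
    "\<And>i. i \<in> I \<Longrightarrow> p i \<in> E" "\<And>i. i \<in> I \<Longrightarrow> i \<in> p i" "\<And>i. i \<in> I \<Longrightarrow> p i \<subseteq> I"
    "\<And>i. i \<in> I \<Longrightarrow> card (p i) = 2"
proof -
  \<comment> \<open>A tree on \<open>V\<close> given by parent edges. Injectivity leaves out
    \<open>u\<close> because \<open>u\<close> and \<open>v\<close> share the root edge. Keeping the
    edges inside \<open>V\<close> makes every later edge a new one.\<close>
  define P where "P V \<longleftrightarrow> u \<in> V \<and> v \<in> V \<and>
    (\<exists>p. p u = {u, v} \<and> p v = {u, v} \<and> inj_on p (V - {u}) \<and> cut_connected V (p ` V) \<and>
      (\<forall>i\<in>V. p i \<in> E \<and> i \<in> p i \<and> p i \<subseteq> V \<and> card (p i) = 2))" for V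
  have "P I"
  proof (rule finite_grow_induct[OF fin, of "{u, v}"])
    have "cut_connected {u, v} {{u, v}}"
      unfolding cut_connected_def by (auto simp: insert_commute)
    then show "P {u, v}"
      unfolding P_def using uv by (intro conjI exI[of _ "\<lambda>_. {u, v}"]) (auto simp: inj_on_def)
  next
    fix V assume V: "V \<subset> I" and "P V"
    then obtain p where V_uv: "u \<in> V" "v \<in> V" and p_uv: "p u = {u, v}" "p v = {u, v}"
      and inj: "inj_on p (V - {u})" and cc: "cut_connected V (p ` V)"
      and p: "\<And>i. i \<in> V \<Longrightarrow> p i \<in> E \<and> i \<in> p i \<and> p i \<subseteq> V \<and> card (p i) = 2"
      unfolding P_def by blast
    obtain b where "b \<in> I" "b \<notin> V" using V by blast
    then obtain z w where zw: "z \<in> V" "w \<in> I" "w \<notin> V" "{z, w} \<in> E"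
      using cut_connectedE[OF conn uv(1) V_uv(1)] by metis
    define q where "q = p(w := {z, w})"
    have q_old: "q i = p i" if "i \<in> V" for i using that zw by (auto simp: q_def)
    have q_w: "q w = {z, w}" by (simp add: q_def)
    have img: "q ` insert w V = insert {z, w} (p ` V)" using q_old q_w by auto
    have "cut_connected (insert w V) (insert {z, w} (p ` V))"
      unfolding cut_connected_def
    proof (intro allI impI)
      fix X assume X: "insert w V \<inter> X \<noteq> {}" "insert w V - X \<noteq> {}"
      show "\<exists>a\<in>insert w V \<inter> X. \<exists>b\<in>insert w V - X. {a, b} \<in> insert {z, w} (p ` V)"
      proof (cases "V \<inter> X \<noteq> {} \<and> V - X \<noteq> {}")
        case True
        then obtain a b where "a \<in> V \<inter> X" "b \<in> V - X" "{a, b} \<in> p ` V"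
          using cc unfolding cut_connected_def by meson
        then show ?thesis by blast
      next
        case False
        \<comment> \<open>The cut keeps \<open>V\<close> on one side, so it separates
          \<open>w\<close> from all of \<open>V\<close>, in particular from
          \<open>z\<close>.\<close>
        then consider "z \<in> X" "w \<notin> X" | "z \<notin> X" "w \<in> X" using X zw by blast
        then show ?thesis
          by cases (use zw(1) in \<open>auto simp: insert_commute\<close>)
      qed
    qed
    moreover have "inj_on q (insert w V - {u})"
    proof -
      \<comment> \<open>Old edges lie inside \<open>V\<close> and miss \<open>w\<close>, so the edge
        at \<open>w\<close> differs from all of them.\<close>
      have "w \<notin> q i" if "i \<in> V" for i using p[OF that] q_old[OF that] zw by blast
      then have "q w \<notin> q ` (V - {u})" using q_w by blast
      moreover have "inj_on q (V - {u})" using inj q_old unfolding inj_on_def by simp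
      moreover have "insert w V - {u} = insert w (V - {u})" using zw V_uv by blast
      moreover have "w \<notin> V - {u}" using zw by blast
      ultimately show ?thesis by simp
    qed
    moreover have "card {z, w} = 2" using zw by (metis card_2_iff)
    then have "q i \<in> E \<and> i \<in> q i \<and> q i \<subseteq> insert w V \<and> card (q i) = 2"
      if "i \<in> insert w V" for i
      using that p q_old q_w zw by (cases "i = w") auto
    ultimately have "P (insert w V)"
      unfolding P_def using V_uv p_uv q_old img by (intro conjI exI[of _ q]) auto
    then show "\<exists>w\<in>I - V. P (insert w V)" using zw by blast
  qed (use uv in auto)
  then show thesis using that unfolding P_def by metis
qed

text \<open>The parent edges around any root edge form a spanning tree, of which only connectivity
  and the number of edges are recorded.\<close>

lemma cut_connected_ex_sparse:
  assumes fin: "finite I" and "cut_connected I K" and card_I: "2 \<le> card I"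
  obtains E where "finite E" "E \<subseteq> K" "\<And>e. e \<in> E \<Longrightarrow> card e = 2 \<and> e \<subseteq> I"
    "cut_connected I E" "card E < card I"
proof -
  obtain u where u: "u \<in> I" using card_ge_2_ex_neq[OF card_I] by blast
  obtain w where "w \<in> I" "u \<noteq> w" using card_ge_2_ex_neq[OF card_I] by metis
  then obtain v where v: "v \<in> I" "v \<noteq> u" "{u, v} \<in> K"
    using cut_connected_ex_edge[OF assms(2) u] by metis
  then obtain p where p: "p u = {u, v}" "p v = {u, v}" "cut_connected I (p ` I)"
    "\<And>i. i \<in> I \<Longrightarrow> p i \<in> K \<and> p i \<subseteq> I \<and> card (p i) = 2"
    using cut_connected_ex_parent_edges[OF fin assms(2) u, of v] by metis
  \<comment> \<open>\<open>u\<close> repeats the edge of \<open>v\<close>, so dropping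
    \<open>u\<close> does not change the image.\<close>
  have "p u \<in> p ` (I - {u})" using p(1,2) v by (intro image_eqI[of _ _ v]) auto
  moreover have "p ` I = insert (p u) (p ` (I - {u}))" using u by blast
  ultimately have "p ` I = p ` (I - {u})" by blast
  then have "card (p ` I) \<le> card (I - {u})" using fin by (simp add: card_image_le)
  also have "\<dots> < card I" using fin u by (rule card_Diff1_less)
  finally show thesis using that[of "p ` I"] fin p by blast
qed

section \<open>Generating \<open>NC I A\<close> from a sparse connected graph\<close>

lemma in_NC_iff:
  assumes "I \<noteq> {}"
  shows "x \<in> NC I A \<longleftrightarrow> x \<in> I \<rightarrow>\<^sub>E A \<and> (\<exists>u\<in>I. \<exists>v\<in>I. x u \<noteq> x v)"
proof -
  obtain w where w: "w \<in> I" using assms by blast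
  have "(\<exists>a\<in>A. \<forall>i\<in>I. x i = a) \<longleftrightarrow> (\<forall>u\<in>I. \<forall>v\<in>I. x u = x v)" if "x \<in> I \<rightarrow>\<^sub>E A"
  proof -
    have "x w \<in> A" using that w by auto
    then show ?thesis using w by metis
  qed
  then show ?thesis unfolding NC_def by blast
qed

lemma sparse_graph_generates_NC:
  assumes finA: "finite A" and finI: "finite I" and cardA: "2 \<le> card A" and cardI: "2 \<le> card I"
    and K: "complex_over I K" and finE: "finite E" and EK: "E \<subseteq> K"
    and card_e: "\<And>e. e \<in> E \<Longrightarrow> card e = 2" and e_sub: "\<And>e. e \<in> E \<Longrightarrow> e \<subseteq> I"
    and conn: "cut_connected I E" and cardE: "card E < card I"
  shows "generates I K (NC I A)"
proof -
  \<comment> \<open>\<open>D\<close> holds the proposals of two distinct letters. The input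
    \<open>Inl i\<close> is private to the vertex \<open>i\<close>, and \<open>Inr e\<close> is
    shared by the endpoints of \<open>e\<close>. All inputs need one alphabet, so
    \<open>E \<times> D\<close> serves both: vertices use the first component, edges the
    second.\<close>
  define D where "D = {(a, b). a \<in> A \<and> b \<in> A \<and> a \<noteq> b}"
  define J where "J = Inl ` I \<union> Inr ` E"
  \<comment> \<open>Edges are unordered, so \<open>hd e\<close> fixes the endpoint that receives the
    first letter of the pair.\<close>
  define hd where "hd e = (SOME i. i \<in> e)" for e :: "'b set"
  \<comment> \<open>An input may name an edge not incident to \<open>i\<close>;
    \<open>dflt i\<close> then replaces it.\<close>
  define dflt where "dflt i = (SOME e. e \<in> E \<and> i \<in> e)" for i
  define sel where "sel x i = (if i \<in> fst (x (Inl i)) then fst (x (Inl i)) else dflt i)"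
    for x :: "'b + 'b set \<Rightarrow> 'b set \<times> 'a \<times> 'a" and i
  define f where "f x = (\<lambda>i\<in>I. if i = hd (sel x i) then fst (snd (x (Inr (sel x i))))
      else snd (snd (x (Inr (sel x i)))))" for x :: "'b + 'b set \<Rightarrow> 'b set \<times> 'a \<times> 'a"
  let ?B = "E \<times> D"
  have neI: "I \<noteq> {}" using cardI by auto
  have finJ: "finite J" using finI finE by (simp add: J_def)
  have finB: "finite ?B"
  proof -
    have "D \<subseteq> A \<times> A" by (auto simp: D_def)
    then show ?thesis using finA finE by (meson finite_SigmaI finite_subset)
  qed
  have dflt: "dflt i \<in> E \<and> i \<in> dflt i" if "i \<in> I" for i
  proof -
    obtain j where "j \<in> I" "i \<noteq> j" using card_ge_2_ex_neq[OF cardI] by metis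
    then obtain k where "{i, k} \<in> E"
      using cut_connected_ex_edge[OF conn \<open>i \<in> I\<close>] by blast
    then have "\<exists>e. e \<in> E \<and> i \<in> e" by blast
    then show ?thesis unfolding dflt_def by (rule someI_ex)
  qed
  have hd: "hd e \<in> e" if "e \<in> E" for e
  proof -
    have "e \<noteq> {}" using card_e[OF that] by auto
    then show ?thesis unfolding hd_def by (simp add: some_in_eq)
  qed
  have sel: "sel x i \<in> E \<and> i \<in> sel x i" if "x \<in> J \<rightarrow>\<^sub>E ?B" "i \<in> I" for x i
  proof -
    have "x (Inl i) \<in> ?B" using that by (intro PiE_mem[OF that(1)]) (simp add: J_def)
    then have "fst (x (Inl i)) \<in> E" by auto
    then show ?thesis using dflt[OF that(2)] by (auto simp: sel_def)
  qed
  have val: "snd (x (Inr e)) \<in> D" if "x \<in> J \<rightarrow>\<^sub>E ?B" "e \<in> E" for x e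
  proof -
    have "x (Inr e) \<in> ?B" using that by (intro PiE_mem[OF that(1)]) (simp add: J_def)
    then show ?thesis by auto
  qed
  have win: "window ?B J f i \<subseteq> insert (Inl i) (Inr ` {e \<in> E. i \<in> e})" if i: "i \<in> I" for i
  proof (rule window_least[OF finJ])
    show "determines ?B J f i (insert (Inl i) (Inr ` {e \<in> E. i \<in> e}))"
      unfolding determines_def
    proof (intro conjI ballI impI)
      show "insert (Inl i) (Inr ` {e \<in> E. i \<in> e}) \<subseteq> J" using i by (auto simp: J_def)
    next
      fix x y assume x: "x \<in> J \<rightarrow>\<^sub>E ?B"
        and eq: "\<forall>j\<in>insert (Inl i) (Inr ` {e \<in> E. i \<in> e}). x j = y j"
      then have "sel x i = sel y i" by (simp add: sel_def)
      moreover have "x (Inr (sel x i)) = y (Inr (sel x i))" using eq sel[OF x i] by simp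
      ultimately show "f x i = f y i" by (simp add: f_def)
    qed
  qed
  have "comm_complex I ?B J f \<subseteq> K"
  proof
    fix S assume "S \<in> comm_complex I ?B J f"
    then obtain j where S: "S \<subseteq> I" and j: "j \<in> J" "\<And>i. i \<in> S \<Longrightarrow> j \<in> window ?B J f i"
      by (auto simp: comm_complex_def)
    \<comment> \<open>An input at a vertex can be read by that vertex alone, which lies on some
      edge; an input at an edge can be read by its endpoints only.\<close>
    have "\<exists>e\<in>E. S \<subseteq> e"
    proof (cases j)
      case (Inl k)
      have "S \<subseteq> {k}" using j(2) win S Inl by blast
      then show ?thesis using dflt[of k] j(1) Inl by (auto simp: J_def)
    next
      case (Inr e)
      have "S \<subseteq> e" using j(2) win S Inr by blast
      then show ?thesis using j(1) Inr by (auto simp: J_def)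
    qed
    then show "S \<in> K" using complex_over_subset[OF K] EK by blast
  qed
  moreover have "f ` (J \<rightarrow>\<^sub>E ?B) = NC I A"
  proof
    show "f ` (J \<rightarrow>\<^sub>E ?B) \<subseteq> NC I A"
    proof (rule image_subsetI)
      fix x assume x: "x \<in> J \<rightarrow>\<^sub>E ?B"
      have "f x i \<in> A" if "i \<in> I" for i
        using that val[OF x, of "sel x i"] sel[OF x that] by (auto simp: f_def D_def)
      then have fx: "f x \<in> I \<rightarrow>\<^sub>E A" by (auto simp: f_def)
      have "\<not> inj_on (sel x) I"
      proof (rule pigeonhole)
        have "sel x ` I \<subseteq> E" using sel[OF x] by blast
        then have "card (sel x ` I) \<le> card E" by (rule card_mono[OF finE])
        then show "card (sel x ` I) < card I" using cardE by simp
      qed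
      then obtain u v where uv: "u \<in> I" "v \<in> I" "u \<noteq> v" "sel x u = sel x v"
        unfolding inj_on_def by blast
      define e where "e = sel x u"
      have e: "e \<in> E" "u \<in> e" "v \<in> e"
        using sel[OF x uv(1)] sel[OF x uv(2)] uv(4) by (simp_all add: e_def)
      have "e = {u, v}" using card_e[OF e(1)] e(2,3) uv(3) by (auto simp: card_2_iff)
      then have "u = hd e \<or> v = hd e" using hd[OF e(1)] by (metis insertE singletonD)
      moreover have "fst (snd (x (Inr e))) \<noteq> snd (snd (x (Inr e)))"
        using val[OF x e(1)] by (auto simp: D_def)
      moreover have "f x i = (if i = hd e then fst (snd (x (Inr e))) else snd (snd (x (Inr e))))"
        if "i = u \<or> i = v" for i
        using that uv unfolding e_def f_def by auto
      ultimately have "f x u \<noteq> f x v" using uv(3) by metis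
      then show "f x \<in> NC I A" unfolding in_NC_iff[OF neI] using fx uv(1,2) by blast
    qed
  next
    show "NC I A \<subseteq> f ` (J \<rightarrow>\<^sub>E ?B)"
    proof
      fix y assume "y \<in> NC I A"
      then obtain a b where y: "y \<in> I \<rightarrow>\<^sub>E A" and ab: "a \<in> I" "b \<in> I" "y a \<noteq> y b"
        unfolding in_NC_iff[OF neI] by blast
      \<comment> \<open>The vertices with the value \<open>y a\<close> define a cut, and an edge
        across it becomes the root.\<close>
      obtain u v where uv: "u \<in> I" "v \<in> I" "{u, v} \<in> E" "y u \<noteq> y v"
        by (rule cut_connectedE[OF conn ab(1), of "{i. y i = y a}" b]) (use ab in auto)
      then have "u \<noteq> v" by blast
      then obtain p where p_uv: "p u = {u, v}" "p v = {u, v}" and inj: "inj_on p (I - {u})"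
        and pE: "\<And>i. i \<in> I \<Longrightarrow> p i \<in> E" and p_in: "\<And>i. i \<in> I \<Longrightarrow> i \<in> p i"
        using cut_connected_ex_parent_edges[OF finI conn uv(1,2) _ uv(3)] by metis
      \<comment> \<open>Away from \<open>u\<close> the selections are distinct, so only the root
        edge is selected twice, and \<open>y\<close> differs on its endpoints.\<close>
      have p_neq: "y i \<noteq> y j" if "i \<in> I" "j \<in> I" "i \<noteq> j" "p i = p j" for i j
      proof -
        have "i = u \<or> j = u" using that inj by (meson DiffI inj_on_def singletonD)
        then have "p i = {u, v}" using that p_uv by metis
        then have "{i, j} = {u, v}" using that p_in by (metis insertE insert_commute singletonD)
        then show ?thesis using uv(4) by (metis doubleton_eq_iff)
      qed
      \<comment> \<open>Each edge needs a pair of distinct letters that gives \<open>y i\<close> to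
        every endpoint \<open>i\<close> selecting it.\<close>
      have "\<exists>d\<in>D. \<forall>i\<in>I. p i = e \<longrightarrow> (if i = hd e then fst d else snd d) = y i"
        if e: "e \<in> E" for e
      proof -
        define h where "h = hd e"
        have "card (e - {h}) = 1" using card_e[OF e] hd[OF e] by (simp add: h_def)
        then obtain t where "e - {h} = {t}" by (rule card_1_singletonE)
        then have ht: "e = {h, t}" "h \<noteq> t" "h = hd e" using hd[OF e] unfolding h_def by blast+
        have htI: "h \<in> I" "t \<in> I" using e_sub[OF e] ht(1) by auto
        have yA: "y h \<in> A" "y t \<in> A" using y htI by auto
        have only: "i = h \<or> i = t" if "i \<in> I" "p i = e" for i
          using p_in[OF that(1)] that(2) ht(1) by auto
        have choice: ?thesis
          if "d \<in> D" "p h = e \<Longrightarrow> fst d = y h" "p t = e \<Longrightarrow> snd d = y t" for d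
        proof (intro bexI ballI impI)
          fix i assume "i \<in> I" "p i = e"
          then show "(if i = hd e then fst d else snd d) = y i"
            unfolding ht(3)[symmetric] using only ht(2) that(2,3) by metis
        qed fact
        \<comment> \<open>If \<open>y\<close> agrees on the two endpoints, at most one of them
          selects \<open>e\<close>, and the spare letter \<open>c\<close> goes to one that does
          not.\<close>
        obtain c where c: "c \<in> A" "c \<noteq> y h" using card_ge_2_ex_neq[OF cardA] by metis
        consider "y h \<noteq> y t" | "y h = y t" "p t \<noteq> e" | "y h = y t" "p h \<noteq> e"
          using p_neq[OF htI ht(2)] by metis
        then show ?thesis
        proof cases
          case 1
          then show ?thesis using yA by (intro choice[of "(y h, y t)"]) (auto simp: D_def)
        next
          case 2
          then show ?thesis using yA c by (intro choice[of "(y h, c)"]) (auto simp: D_def)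
        next
          case 3
          then show ?thesis using yA c by (intro choice[of "(c, y h)"]) (auto simp: D_def)
        qed
      qed
      then obtain d where dD: "\<And>e. e \<in> E \<Longrightarrow> d e \<in> D"
        and d: "\<And>e i. e \<in> E \<Longrightarrow> i \<in> I \<Longrightarrow> p i = e \<Longrightarrow>
          (if i = hd e then fst (d e) else snd (d e)) = y i"
        by metis
      define x where "x = (\<lambda>j\<in>J. case j of Inl i \<Rightarrow> (p i, d (p i)) | Inr e \<Rightarrow> (e, d e))"
      have x: "x \<in> J \<rightarrow>\<^sub>E ?B"
        using pE dD by (auto simp: x_def J_def)
      have sel_x: "sel x i = p i" if "i \<in> I" for i
        using that p_in by (simp add: sel_def x_def J_def)
      have "f x = y"
      proof
        fix i show "f x i = y i"
        proof (cases "i \<in> I")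
          case True
          have "x (Inr (p i)) = (p i, d (p i))" using pE[OF True] by (simp add: x_def J_def)
          then have "f x i = (if i = hd (p i) then fst (d (p i)) else snd (d (p i)))"
            using True by (simp add: f_def sel_x)
          also have "\<dots> = y i" using d[OF pE[OF True] True refl] .
          finally show ?thesis .
        next
          case False
          then show ?thesis using PiE_arb[OF y False] by (simp add: f_def)
        qed
      qed
      then show "y \<in> f ` (J \<rightarrow>\<^sub>E ?B)" using x by blast
    qed
  qed
  ultimately have "generates_by I K (NC I A) ?B J f"
    using finB finJ by (simp add: generates_by_def)
  then show ?thesis by (rule generates_by_imp_generates)
qed

section \<open>Disconnected complexes, and the equivalence\<close>

lemma generates_NC_imp_connected:
  fixes A :: "'a set"
  assumes cardA: "2 \<le> card A" and "generates I K (NC I A)"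
  shows "connected_complex I K"
proof
  assume "disconnected_complex I K"
  then obtain I0 I1 where I01: "I0 \<noteq> {}" "I1 \<noteq> {}" "I0 \<inter> I1 = {}" "I0 \<union> I1 = I"
    and S: "\<forall>S\<in>K. S \<subseteq> I0 \<or> S \<subseteq> I1"
    unfolding disconnected_complex_def by blast
  obtain B J :: "nat set" and f where fin: "finite J" and img: "f ` (J \<rightarrow>\<^sub>E B) = NC I A"
    and comm: "comm_complex I B J f \<subseteq> K"
    using assms(2) unfolding generates_def generates_by_def by blast
  note det = window_determines[OF fin, of B f]
  \<comment> \<open>An input read on both sides would put a pair across the splitting into
    \<open>K\<close>.\<close>
  have disj: "j \<notin> window B J f v" if "u \<in> I0" "v \<in> I1" "j \<in> window B J f u" for u v j
  proof
    assume "j \<in> window B J f v"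
    then have "{u, v} \<in> comm_complex I B J f"
      using that I01(4) determines_subset[OF det] by (auto simp: comm_complex_def)
    then show False using comm S that I01(3) by blast
  qed
  have neI: "I \<noteq> {}" using I01 by blast
  obtain a where a: "a \<in> A" using card_ge_2_ex_neq[OF cardA] by blast
  obtain b where b: "b \<in> A" "b \<noteq> a" using card_ge_2_ex_neq[OF cardA] by blast
  have "\<exists>x \<in> J \<rightarrow>\<^sub>E B. f x = (\<lambda>i\<in>I. if i \<in> I0 then c else d)"
    if "c \<in> A" "d \<in> A" "c \<noteq> d" for c d
  proof -
    let ?w = "\<lambda>i\<in>I. if i \<in> I0 then c else d"
    obtain u v where uv: "u \<in> I0" "v \<in> I1" using I01 by blast
    then have "u \<in> I" "v \<in> I" "?w u \<noteq> ?w v" using I01 that by auto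
    moreover have "?w \<in> I \<rightarrow>\<^sub>E A" using that by auto
    ultimately have "?w \<in> NC I A" using in_NC_iff[OF neI] by blast
    then show ?thesis unfolding img[symmetric] by auto
  qed
  then obtain x y where x: "x \<in> J \<rightarrow>\<^sub>E B" "f x = (\<lambda>i\<in>I. if i \<in> I0 then a else b)"
    and y: "y \<in> J \<rightarrow>\<^sub>E B" "f y = (\<lambda>i\<in>I. if i \<in> I0 then b else a)"
    using a b by metis
  \<comment> \<open>The half \<open>I0\<close> reads only inputs taken from \<open>x\<close>, the
    half \<open>I1\<close> only inputs taken from \<open>y\<close>, and both then output
    \<open>a\<close>.\<close>
  define z where "z = (\<lambda>j. if \<exists>u\<in>I0. j \<in> window B J f u then x j else y j)"
  have z: "z \<in> J \<rightarrow>\<^sub>E B"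
    using x(1) y(1) determines_subset[OF det]
    by (auto simp: z_def PiE_iff extensional_def)
  have "f z i = a" if "i \<in> I" for i
  proof (cases "i \<in> I0")
    case True
    then have "\<forall>j\<in>window B J f i. z j = x j" by (auto simp: z_def)
    then have "f z i = f x i" using det x(1) z unfolding determines_def by blast
    then show ?thesis using True that x(2) by simp
  next
    case False
    then have "\<forall>j\<in>window B J f i. z j = y j" using disj that I01 by (auto simp: z_def)
    then have "f z i = f y i" using det y(1) z unfolding determines_def by blast
    then show ?thesis using False that y(2) by simp
  qed
  moreover have "f z \<in> NC I A" using img z by blast
  ultimately show False using a by (auto simp: NC_def)
qed

lemma connected_imp_generates_NC:
  assumes "finite A" "finite I" "2 \<le> card A" "2 \<le> card I" "complex_over I K"
    and "connected_complex I K"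
  shows "generates I K (NC I A)"
proof -
  have "cut_connected I K" using assms(5,6) connected_complex_iff_cut_connected by blast
  then obtain E where E: "finite E" "E \<subseteq> K" "\<And>e. e \<in> E \<Longrightarrow> card e = 2 \<and> e \<subseteq> I"
    "cut_connected I E" "card E < card I"
    using cut_connected_ex_sparse[OF assms(2) _ assms(4)] by metis
  show ?thesis
    by (rule sparse_graph_generates_NC[OF assms(1-5) E(1,2) _ _ E(4,5)]) (use E(3) in auto)
qed

text \<open>The empty language is generated over the empty alphabet \<open>B\<close>; one input is needed to make
  \<open>B\<^sup>J\<close> empty.\<close>

lemma generates_empty_language:
  assumes "complex_over I K" "K \<noteq> {}"
  shows "generates I K ({} :: ('i \<Rightarrow> 'a) set)"
proof -
  let ?f = "\<lambda>_ _. undefined :: 'a"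
  have "window {} {0::nat} ?f i = {}" for i :: 'i
    using window_least[of "{0}" "{}" ?f i "{}"] by (auto simp: determines_def)
  then have "comm_complex I {} {0::nat} ?f \<subseteq> {{}}"
    by (auto simp: comm_complex_def)
  moreover have "{} \<in> K" using assms by (auto simp: complex_over_def)
  ultimately have "generates_by I K ({} :: ('i \<Rightarrow> 'a) set) ({} :: nat set) {0::nat} ?f"
    by (auto simp: generates_by_def)
  then show ?thesis by (rule generates_by_imp_generates)
qed

text \<open>If \<open>I\<close> has at most one point, \<open>NC I A\<close> is empty and both sides
  hold. The void complex must be kept out there: it is connected, but it forces
  \<open>J = {}\<close> and so generates only one-element languages.\<close>

lemma generates_NC_iff_connected:
  fixes A :: "'a set" and I :: "'i set"
  assumes A: "finite A" "2 \<le> card A" and I: "finite I"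
    and K: "complex_over I K" "K \<noteq> {} \<or> 2 \<le> card I"
  shows "generates I K (NC I A) \<longleftrightarrow> connected_complex I K"
proof (cases "2 \<le> card I")
  case True
  then show ?thesis
    using generates_NC_imp_connected connected_imp_generates_NC assms by blast
next
  case False
  then have "card I \<le> 1" by simp
  then have eq: "u = v" if "u \<in> I" "v \<in> I" for u v
    using that card_le_Suc0_iff_eq[OF I] by auto
  obtain a where "a \<in> A" using card_ge_2_ex_neq[OF A(2)] by blast
  then have "NC I A = {}"
  proof (cases "I = {}")
    case False
    have "x u = x v" if "u \<in> I" "v \<in> I" for x :: "'i \<Rightarrow> 'a" and u v
      using eq[OF that] by simp
    then have "x \<notin> NC I A" for x
      unfolding in_NC_iff[OF False] by simp
    then show ?thesis by blast
  qed (auto simp: NC_def)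
  moreover have "K \<noteq> {}" using K(2) False by blast
  ultimately have "generates I K (NC I A)" using generates_empty_language[OF K(1)] by simp
  then show ?thesis using generates_NC_imp_connected[OF A(2)] by blast
qed

section \<open>Spanning trees as minimal connected complexes\<close>

text \<open>Cutting off \<open>i\<close> yields an edge at \<open>i\<close> once there is a second
  vertex. Over a single point even the void complex is connected.\<close>

lemma cut_connected_complex_singleton:
  assumes "complex_over I K" "cut_connected I K" "2 \<le> card I" "i \<in> I"
  shows "{i} \<in> K"
proof -
  obtain j where "j \<in> I" "i \<noteq> j" using card_ge_2_ex_neq[OF assms(3)] by metis
  then obtain k where "{i, k} \<in> K" using cut_connected_ex_edge[OF assms(2,4)] by metis
  then show ?thesis using complex_over_subset[OF assms(1)] by blast
qed

lemma complex_over_graph: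
  assumes "\<And>e. e \<in> E \<Longrightarrow> e \<subseteq> I \<and> card e = 2"
  shows "complex_over I ({{}} \<union> {{i} | i. i \<in> I} \<union> E)"
  unfolding complex_over_def
proof (intro conjI ballI allI impI)
  show "{{}} \<union> {{i} | i. i \<in> I} \<union> E \<subseteq> Pow I" using assms by auto
next
  fix S T assume S: "S \<in> {{}} \<union> {{i} | i. i \<in> I} \<union> E" and T: "T \<subseteq> S"
  show "T \<in> {{}} \<union> {{i} | i. i \<in> I} \<union> E"
  proof (cases "S \<in> E")
    case True
    then obtain u v where "S = {u, v}" using assms by (meson card_2_iff)
    then have "T = {} \<or> T = {u} \<or> T = {v} \<or> T = S" "u \<in> I" "v \<in> I"
      using T assms[OF True] by blast+
    then show ?thesis using True by blast
  next
    case False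
    then show ?thesis using S T by blast
  qed
qed

text \<open>If an edge \<open>{u, v}\<close> of the tree were missing from \<open>K\<close>, a path
  in \<open>K\<close> from \<open>u\<close> to \<open>v\<close> would close up with it to a
  cycle.\<close>

lemma is_tree_subset_connected:
  assumes tree: "is_tree I E" and conn: "cut_connected I K"
    and K: "K \<subseteq> {{}} \<union> {{i} | i. i \<in> I} \<union> E"
  shows "E \<subseteq> K"
proof (rule ccontr)
  assume "\<not> E \<subseteq> K"
  then obtain e where e: "e \<in> E" "e \<notin> K" by blast
  have "card e = 2" "e \<subseteq> I" using tree e(1) unfolding is_tree_def by blast+
  then obtain u v where uv: "e = {u, v}" "u \<noteq> v" "u \<in> I" "v \<in> I"
    by (auto simp: card_2_iff)
  obtain vs where vs: "vs \<noteq> []" "distinct vs" "hd vs = u" "last vs = v"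
    and path: "successively (\<lambda>a b. (a, b) \<in> {(a, b). {a, b} \<in> K}) vs"
    using rtrancl_imp_distinct_path[OF cut_connected_imp_rtrancl[OF conn uv(3,4)]] by blast
  have edge: "{vs ! k, vs ! Suc k} \<in> K" if "Suc k < length vs" for k
    using path that by (simp add: successively_conv_nth)
  have first: "vs ! 0 = u" and last: "vs ! (length vs - 1) = v"
    using vs by (simp_all add: hd_conv_nth last_conv_nth)
  \<comment> \<open>One vertex would mean \<open>u = v\<close>, and two would put the missing edge
    \<open>e\<close> into \<open>K\<close>.\<close>
  have "length vs \<noteq> 1" using first last uv(2) by auto
  moreover have "length vs \<noteq> 2" using edge[of 0] first last uv(1) e(2) by auto
  ultimately have len: "3 \<le> length vs" using vs(1) by (cases "length vs") auto
  have "{vs ! k, vs ! (Suc k mod length vs)} \<in> E" if k: "k < length vs" for k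
  proof (cases "Suc k < length vs")
    case True
    \<comment> \<open>Consecutive vertices differ, so their pair in \<open>K\<close> is an edge and
      not a singleton simplex.\<close>
    then have "vs ! k \<noteq> vs ! Suc k" using vs(2) by (simp add: nth_eq_iff_index_eq)
    then show ?thesis using edge[OF True] K True by (auto simp: doubleton_eq_iff)
  next
    case False
    then have "k = length vs - 1" "Suc k = length vs" using k by auto
    then show ?thesis using first last uv(1) e(1) by (simp add: insert_commute)
  qed
  then have "is_cycle E vs" using len vs(2) by (simp add: is_cycle_def)
  then show False using tree unfolding is_tree_def by blast
qed

text \<open>A cut crossed by the removed edge is crossed again by the rest of the cycle. Removing
  the wrap-around edge leaves the path given by the list itself.\<close>

lemma is_cycle_remove_edge_connected:
  assumes cyc: "is_cycle E vs" and conn: "cut_connected I K" and "E \<subseteq> K"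
    and E: "\<And>e. e \<in> E \<Longrightarrow> e \<subseteq> I"
  shows "cut_connected I (K - {{vs ! 0, vs ! (length vs - 1)}})"
  unfolding cut_connected_def
proof (intro allI impI)
  let ?n = "length vs"
  let ?e = "{vs ! 0, vs ! (?n - 1)}"
  fix X assume "I \<inter> X \<noteq> {}" "I - X \<noteq> {}"
  then obtain u v where uv: "u \<in> I \<inter> X" "v \<in> I - X" "{u, v} \<in> K"
    using conn unfolding cut_connected_def by meson
  show "\<exists>u\<in>I \<inter> X. \<exists>v\<in>I - X. {u, v} \<in> K - {?e}"
  proof (cases "{u, v} = ?e")
    case False
    then show ?thesis using uv by blast
  next
    case True
    have n: "3 \<le> ?n" and dist: "distinct vs" using cyc by (auto simp: is_cycle_def)
    \<comment> \<open>Otherwise the whole cycle would lie on the side of \<open>vs ! 0\<close>,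
      although the removed edge crosses the cut.\<close>
    have "\<exists>k. Suc k < ?n \<and> (vs ! k \<in> X) \<noteq> (vs ! Suc k \<in> X)"
    proof (rule ccontr)
      assume *: "\<nexists>k. Suc k < ?n \<and> (vs ! k \<in> X) \<noteq> (vs ! Suc k \<in> X)"
      have "k < ?n \<longrightarrow> (vs ! k \<in> X) = (vs ! 0 \<in> X)" for k
        by (induction k) (use * in auto)
      then have "(vs ! (?n - 1) \<in> X) = (vs ! 0 \<in> X)" using n by simp
      then show False using True uv(1,2) by (auto simp: doubleton_eq_iff)
    qed
    then obtain k where k: "Suc k < ?n" "(vs ! k \<in> X) \<noteq> (vs ! Suc k \<in> X)" by blast
    have kE: "{vs ! k, vs ! Suc k} \<in> E"
      using cyc k(1) unfolding is_cycle_def by (metis Suc_lessD mod_less)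
    \<comment> \<open>As the vertices are distinct, a consecutive pair could equal the wrap-around
      edge only if there were just two of them.\<close>
    have "{vs ! k, vs ! Suc k} \<noteq> ?e"
    proof
      assume "{vs ! k, vs ! Suc k} = ?e"
      then consider "vs ! k = vs ! 0" "vs ! Suc k = vs ! (?n - 1)" | "vs ! Suc k = vs ! 0"
        by (auto simp: doubleton_eq_iff)
      then show False
      proof cases
        case 1
        then have "k = 0" "Suc k = ?n - 1"
          using dist k(1) n nth_eq_iff_index_eq[OF dist, of k 0]
            nth_eq_iff_index_eq[OF dist, of "Suc k" "?n - 1"] by linarith+
        then show False using n by simp
      next
        case 2
        then show False using k(1) nth_eq_iff_index_eq[OF dist, of "Suc k" 0] by fastforce
      qed
    qed
    then have *: "{vs ! k, vs ! Suc k} \<in> K - {?e}" using kE assms(3) by blast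
    have I: "vs ! k \<in> I" "vs ! Suc k \<in> I" using E[OF kE] by auto
    show ?thesis
    proof (cases "vs ! k \<in> X")
      case True
      then show ?thesis using * k(2) I by blast
    next
      case False
      have "{vs ! Suc k, vs ! k} \<in> K - {?e}" using * by (simp only: insert_commute)
      then show ?thesis using False k(2) I by blast
    qed
  qed
qed

lemma spanning_tree_complex_connected:
  assumes "spanning_tree_complex I K"
  shows "complex_over I K" "cut_connected I K"
proof -
  obtain E where tree: "is_tree I E" and K: "K = {{}} \<union> {{i} | i. i \<in> I} \<union> E"
    using assms unfolding spanning_tree_complex_def by blast
  show "complex_over I K"
    unfolding K by (rule complex_over_graph) (use tree in \<open>auto simp: is_tree_def\<close>)
  have "cut_connected I E"
    by (rule rtrancl_imp_cut_connected) (use tree in \<open>auto simp: is_tree_def\<close>)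
  then show "cut_connected I K" by (rule cut_connected_mono) (use K in blast)
qed

lemma spanning_tree_complex_minimal:
  assumes "spanning_tree_complex I K" "complex_over I K'" "K' \<subseteq> K" "cut_connected I K'"
    and "2 \<le> card I"
  shows "K' = K"
proof
  obtain E where tree: "is_tree I E" and K: "K = {{}} \<union> {{i} | i. i \<in> I} \<union> E"
    using assms unfolding spanning_tree_complex_def by blast
  have "E \<subseteq> K'" using is_tree_subset_connected[OF tree assms(4)] assms(3) K by blast
  moreover have single: "{i} \<in> K'" if "i \<in> I" for i
    using cut_connected_complex_singleton[OF assms(2,4,5) that] .
  moreover have "{} \<in> K'"
  proof -
    obtain i where "i \<in> I" using card_ge_2_ex_neq[OF assms(5)] by blast
    then show ?thesis using single complex_over_subset[OF assms(2)] by blast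
  qed
  ultimately show "K \<subseteq> K'" using K by blast
qed fact

text \<open>The vertices and edges of \<open>K\<close> already form a connected complex, so
  minimality makes \<open>K\<close> a graph. An edge on a cycle could be removed, so there is no
  cycle.\<close>

lemma minimal_connected_imp_spanning_tree_complex:
  assumes K: "complex_over I K" and conn: "cut_connected I K" and card_I: "2 \<le> card I"
    and minimal: "\<And>K'. complex_over I K' \<Longrightarrow> K' \<subseteq> K \<Longrightarrow> cut_connected I K' \<Longrightarrow> K' = K"
  shows "spanning_tree_complex I K"
proof -
  define E where "E = {e \<in> K. card e = 2}"
  have E: "e \<subseteq> I \<and> card e = 2" if "e \<in> E" for e
    using that K unfolding E_def complex_over_def by blast
  have cE: "cut_connected I E"
    unfolding cut_connected_def
  proof (intro allI impI)
    fix X assume "I \<inter> X \<noteq> {}" "I - X \<noteq> {}"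
    then obtain u v where uv: "u \<in> I \<inter> X" "v \<in> I - X" "{u, v} \<in> K"
      using conn unfolding cut_connected_def by meson
    then have "u \<noteq> v" by blast
    then have "{u, v} \<in> E" using uv(3) by (simp add: E_def)
    then show "\<exists>u\<in>I \<inter> X. \<exists>v\<in>I - X. {u, v} \<in> E" using uv by blast
  qed
  have single: "{i} \<in> K" if "i \<in> I" for i
    using cut_connected_complex_singleton[OF K conn card_I that] .
  obtain i where i: "i \<in> I" using card_ge_2_ex_neq[OF card_I] by blast
  have "{} \<in> K" using complex_over_subset[OF K single[OF i]] by blast
  then have "{{}} \<union> {{i} | i. i \<in> I} \<union> E \<subseteq> K" using single by (auto simp: E_def)
  moreover have "cut_connected I ({{}} \<union> {{i} | i. i \<in> I} \<union> E)"
    using cE by (rule cut_connected_mono) blast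
  ultimately have K_eq: "{{}} \<union> {{i} | i. i \<in> I} \<union> E = K"
    using minimal complex_over_graph E by blast
  have "\<not> is_cycle E vs" for vs
  proof
    assume cyc: "is_cycle E vs"
    define e where "e = {vs ! 0, vs ! (length vs - 1)}"
    have len: "3 \<le> length vs" using cyc by (simp add: is_cycle_def)
    \<comment> \<open>The last index wraps around to \<open>0\<close>, so \<open>e\<close> is the
      closing edge of the cycle.\<close>
    have "{vs ! (length vs - 1), vs ! (Suc (length vs - 1) mod length vs)} \<in> E"
      using cyc len unfolding is_cycle_def
      by (metis diff_less less_le_trans zero_less_numeral zero_less_one)
    moreover have "Suc (length vs - 1) mod length vs = 0"
      using len by (metis Suc_diff_1 mod_self less_le_trans zero_less_numeral)
    ultimately have eE: "e \<in> E" by (simp add: e_def insert_commute)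
    \<comment> \<open>Having two elements, \<open>e\<close> is neither empty nor a vertex, so its
      removal leaves a graph on the same vertices.\<close>
    have "card e = 2" using E eE by blast
    then have "K - {e} = {{}} \<union> {{i} | i. i \<in> I} \<union> (E - {e})"
      unfolding K_eq[symmetric] by auto
    moreover have "complex_over I ({{}} \<union> {{i} | i. i \<in> I} \<union> (E - {e}))"
      by (rule complex_over_graph) (use E in blast)
    ultimately have "complex_over I (K - {e})" by simp
    moreover have "cut_connected I (K - {e})"
      unfolding e_def
    proof (rule is_cycle_remove_edge_connected[OF cyc conn])
      show "E \<subseteq> K" by (auto simp: E_def)
    qed (use E in blast)
    ultimately have "K - {e} = K" using minimal by blast
    then show False using eE by (auto simp: E_def)
  qed
  then have "is_tree I E"
    unfolding is_tree_def using i E cut_connected_imp_rtrancl[OF cE] by blast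
  then show ?thesis unfolding spanning_tree_complex_def using K_eq by blast
qed

text \<open>For \<open>card I \<le> 1\<close> the language is empty and its only minimal complex is
  \<open>{{}}\<close>, which is not a spanning tree; hence the bound in the second part.\<close>

theorem proposition3p3:
  fixes A :: "'a set" and I :: "'i set"
  assumes "finite A" and "finite I" and "2 \<le> card A"
  shows "(\<forall>K. complex_over I K \<and> (K \<noteq> {} \<or> 2 \<le> card I) \<longrightarrow>
            (generates I K (NC I A) \<longleftrightarrow> connected_complex I K))
       \<and> (2 \<le> card I \<longrightarrow>
            {K. minimal_generating I K (NC I A)} = {K. spanning_tree_complex I K})"
proof (intro conjI allI impI)
  fix K assume "complex_over I K \<and> (K \<noteq> {} \<or> 2 \<le> card I)"
  then show "generates I K (NC I A) \<longleftrightarrow> connected_complex I K"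
    using generates_NC_iff_connected assms by blast
next
  assume card_I: "2 \<le> card I"
  have gen: "generates I K (NC I A) \<longleftrightarrow> cut_connected I K" if "complex_over I K" for K
    using that card_I assms generates_NC_iff_connected connected_complex_iff_cut_connected
    by metis
  have "minimal_generating I K (NC I A) \<longleftrightarrow> spanning_tree_complex I K" for K
  proof
    assume "minimal_generating I K (NC I A)"
    then have "complex_over I K" "cut_connected I K"
      "\<And>K'. complex_over I K' \<Longrightarrow> K' \<subseteq> K \<Longrightarrow> cut_connected I K' \<Longrightarrow> K' = K"
      unfolding minimal_generating_def using gen by blast+
    then show "spanning_tree_complex I K"
      using minimal_connected_imp_spanning_tree_complex card_I by blast
  next
    assume tree: "spanning_tree_complex I K"
    show "minimal_generating I K (NC I A)"
      unfolding minimal_generating_def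
      using spanning_tree_complex_connected[OF tree] gen
        spanning_tree_complex_minimal[OF tree _ _ _ card_I]
      by (metis psubsetE subset_refl)
  qed
  then show "{K. minimal_generating I K (NC I A)} = {K. spanning_tree_complex I K}" by blast
qed

end
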